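(* Let $\mathcal{I}\subset NC$ be the two-sided ideal generated by the elements $X_{2n}=\sum_{i+j=2n}(-1)^i h_ih_j$ ($i,j\geq 0$, $n\ge1$), and let $\Pi\subset\mathcal{Q}\mathit{sym}$ be the peak algebra. Then $$\bigl(\mathbb{Q}\otimes NC/\mathcal{I}\bigr)^*\;\cong\;\mathbb{Q}\otimes\Pi ,$$ where $(\cdot)^*$ is the graded dual, identified with the subspace of $\mathbb{Q}\otimes\mathcal{Q}\mathit{sym}$ of functionals annihilating $\mathcal{I}$; under this identification the dual is $\mathbb{Q}\otimes\Pi$.
   Context: $NC=\mathbb{Z}\langle h_1,h_2,\ldots\rangle$ is the Hopf algebra of noncommutative symmetric functions: the free associative algebra with one generator $h_k$ in each degree $k\ge1$, $\Delta h_k=\sum_{i=0}^k h_i\otimes h_{k-i}$, $h_0=1$. $\mathcal{Q}\mathit{sym}$ is the Hopf algebra of quasi-symmetric functions over $\mathbb{Z}$, the graded Hopf dual of $NC$: the monomial basis $M_\alpha=\sum_{i_1<\cdots<i_\ell} z_{i_1}^{\alpha_1}\cdots z_{i_\ell}^{\alpha_\ell}$ is dual to the basis $S^\alpha=h_{\alpha_1}\cdots h_{\alpha_\ell}$ ($\alpha$ a composition). Thus $X_{2n}=2h_{2n}+\sum_{i=1}^{2n-1}(-1)^ih_ih_{2n-i}$. For compositions $\alpha,\beta$ of $m$, write $\beta\preccurlyeq\alpha$ if $\beta$ is a refinement of $\alpha$. Let $\beta^*$ be the refinement of $\beta$ obtained by replacing every component $\beta_i>1$ with $i>1$ by the two components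 $1,\beta_i-1$. Let $k(\beta)$ be the number of components of $\beta$. For a composition $\alpha$ of $m$ with $\alpha_1>1$ if $m>1$, define $$\theta_\alpha=\sum_{\beta\models m,\ \beta^*\preccurlyeq\alpha}2^{k(\beta)}M_\beta .$$ A peak composition is a composition all of whose components are greater than $1$, except perhaps the last; for such $\alpha$, $\theta_\alpha$ is called a peak function. $\Pi$ is the linear span of the peak functions (including $\theta_\emptyset=1$); it is known to be a Hopf subalgebra of $\mathcal{Q}\mathit{sym}$. *)

theory Defs
  imports Complex_Main "HOL-Library.Poly_Mapping" "HOL-Library.Function_Algebras"
begin

section \<open>Compositions\<close>

typedef composition = "{xs :: nat list. 0 \<notin> set xs}"
  morphisms parts Composition
  by (rule exI[of _ "[]"]) simp

setup_lifting type_definition_composition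

text \<open>
  Addition of compositions is concatenation of lists of parts.  Compositions thus form the free
  monoid on the positive integers, and \<open>composition \<Rightarrow>\<^sub>0 'a\<close>, with the convolution product of the
  library, is the free associative algebra on letters of degrees 1, 2, 3, ...
\<close>

instantiation composition :: monoid_add
begin

lift_definition zero_composition :: composition is "[]" by simp

lift_definition plus_composition :: "composition \<Rightarrow> composition \<Rightarrow> composition" is "(@)" by auto

instance by standard (transfer, simp)+

end

definition weight :: "composition \<Rightarrow> nat"
  where "weight \<alpha> = sum_list (parts \<alpha>)"

definition len :: "composition \<Rightarrow> nat"
  where "len \<alpha> = length (parts \<alpha>)"

text \<open>\<open>\<beta>\<close> refines \<open>\<alpha>\<close>: consecutive blocks of \<open>\<beta>\<close> have the parts of \<open>\<alpha>\<close> as their sums.\<close>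

definition refines :: "composition \<Rightarrow> composition \<Rightarrow> bool"  (infix "\<preceq>" 50)
  where "\<beta> \<preceq> \<alpha> \<longleftrightarrow> (\<exists>bs. concat bs = parts \<beta> \<and> map sum_list bs = parts \<alpha>)"

fun star_list :: "nat list \<Rightarrow> nat list" where
  "star_list [] = []"
| "star_list (b # bs) = b # concat (map (\<lambda>c. if c > 1 then [1, c - 1] else [c]) bs)"

lift_definition star :: "composition \<Rightarrow> composition" is star_list
  subgoal for xs by (cases xs) auto
  done

definition peak_composition :: "composition \<Rightarrow> bool"
  where "peak_composition \<alpha> \<longleftrightarrow> (\<forall>b \<in> set (butlast (parts \<alpha>)). b > 1)"

lemma finite_weight: "finite {\<alpha>. weight \<alpha> = m}"
proof -
  have "parts ` {\<alpha>. weight \<alpha> = m} \<subseteq> {xs. set xs \<subseteq> {..m} \<and> length xs \<le> m}"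
  proof clarify
    fix \<alpha> assume m: "m = weight \<alpha>"
    have "0 \<notin> set (parts \<alpha>)" using parts[of \<alpha>] by simp
    then have "length xs \<le> sum_list xs" if "0 \<notin> set xs" for xs :: "nat list"
      using that by (induction xs) auto
    with parts[of \<alpha>] show "set (parts \<alpha>) \<subseteq> {..weight \<alpha>} \<and> length (parts \<alpha>) \<le> weight \<alpha>"
      by (auto simp: weight_def intro: member_le_sum_list)
  qed
  then have "finite (parts ` {\<alpha>. weight \<alpha> = m})"
    by (rule finite_subset) (simp add: finite_lists_length_le)
  then show ?thesis
    by (rule finite_imageD) (simp add: inj_on_def parts_inject)
qed


section \<open>Noncommutative symmetric functions\<close>

definition h :: "nat \<Rightarrow> (composition \<Rightarrow>\<^sub>0 'a::ring_1)"
  where "h k = (if k = 0 then 1 else Poly_Mapping.single (Composition [k]) 1)"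

definition S :: "composition \<Rightarrow> (composition \<Rightarrow>\<^sub>0 'a::ring_1)"
  where "S \<alpha> = prod_list (map h (parts \<alpha>))"

lemma parts_pos: "0 \<notin> set (parts \<alpha>)"
  using parts[of \<alpha>] by simp

lemma S_eq_single: "S \<alpha> = Poly_Mapping.single \<alpha> 1"
proof -
  have "prod_list (map h xs) = Poly_Mapping.single (Composition xs) (1 :: 'a)"
    if "0 \<notin> set xs" for xs
    using that
  proof (induction xs)
    case Nil
    then show ?case by (simp flip: zero_composition_def)
  next
    case (Cons x xs)
    then have "Composition [x] + Composition xs = Composition (x # xs)"
      by (simp add: plus_composition_def Composition_inverse)
    with Cons show ?case by (auto simp: h_def mult_single)
  qed
  from this[OF parts_pos, of \<alpha>] show ?thesis by (simp add: S_def parts_inverse)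
qed

text \<open>\<open>X n\<close> is the element of degree \<open>2 n\<close>.\<close>

definition X :: "nat \<Rightarrow> (composition \<Rightarrow>\<^sub>0 'a::ring_1)"
  where "X n = (\<Sum>i\<le>2 * n. (- 1) ^ i * h i * h (2 * n - i))"

definition two_sided_ideal :: "'b::ring_1 set \<Rightarrow> bool"
  where "two_sided_ideal J \<longleftrightarrow>
    0 \<in> J \<and> (\<forall>x\<in>J. \<forall>y\<in>J. x + y \<in> J) \<and> (\<forall>x\<in>J. \<forall>r. r * x \<in> J \<and> x * r \<in> J)"

definition ideal_I :: "(composition \<Rightarrow>\<^sub>0 int) set"
  where "ideal_I = two_sided_ideal hull {X n | n. n \<ge> 1}"

definition nc_scale :: "'a::comm_ring_1 \<Rightarrow> (composition \<Rightarrow>\<^sub>0 'a) \<Rightarrow> (composition \<Rightarrow>\<^sub>0 'a)"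
  where "nc_scale c x = Poly_Mapping.single 0 c * x"

global_interpretation nc: module nc_scale
proof
  fix a b :: 'a and x y :: "composition \<Rightarrow>\<^sub>0 'a"
  have one: "Poly_Mapping.single (0 :: composition) (1 :: 'a) = 1" by simp
  show "nc_scale 1 x = x" unfolding nc_scale_def one by simp
qed (simp_all add: nc_scale_def algebra_simps single_add mult_single flip: mult.assoc)

text \<open>
  Throughout, the tensor product of \<open>\<rat>\<close> with a group of integer-valued functions is the rational
  span of that group inside the rational-valued functions; the canonical map between the two is an
  isomorphism because such a group is torsion-free.
\<close>

definition ideal_IQ :: "(composition \<Rightarrow>\<^sub>0 rat) set"
  where "ideal_IQ = nc.span (Poly_Mapping.map rat_of_int ` ideal_I)"

quotient_type ncq = "composition \<Rightarrow>\<^sub>0 rat" / "\<lambda>x y. x - y \<in> ideal_IQ"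
  morphisms rep_ncq proj
proof (rule equivpI)
  show "reflp (\<lambda>x y. x - y \<in> ideal_IQ)"
    by (simp add: reflp_def ideal_IQ_def nc.span_zero)
  show "symp (\<lambda>x y. x - y \<in> ideal_IQ)"
    unfolding symp_def ideal_IQ_def by (metis minus_diff_eq nc.span_neg)
  show "transp (\<lambda>x y. x - y \<in> ideal_IQ)"
    unfolding transp_def ideal_IQ_def
  proof clarify
    fix x y z assume "x - y \<in> nc.span (Poly_Mapping.map rat_of_int ` ideal_I)"
      and "y - z \<in> nc.span (Poly_Mapping.map rat_of_int ` ideal_I)"
    then have "(x - y) + (y - z) \<in> nc.span (Poly_Mapping.map rat_of_int ` ideal_I)"
      by (rule nc.span_add)
    then show "x - z \<in> nc.span (Poly_Mapping.map rat_of_int ` ideal_I)" by simp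
  qed
qed

instantiation ncq :: ab_group_add
begin

lift_definition zero_ncq :: ncq is 0 .

lift_definition plus_ncq :: "ncq \<Rightarrow> ncq \<Rightarrow> ncq" is "(+)"
  unfolding ideal_IQ_def by (subst add_diff_add) (rule nc.span_add)

lift_definition uminus_ncq :: "ncq \<Rightarrow> ncq" is uminus
  unfolding ideal_IQ_def by (subst minus_diff_minus) (rule nc.span_neg)

definition minus_ncq :: "ncq \<Rightarrow> ncq \<Rightarrow> ncq" where "minus_ncq x y = x + - y"

instance
proof
  fix a b c :: ncq
  show "a + b + c = a + (b + c)" "a + b = b + a" "0 + a = a" "- a + a = 0"
    by (transfer, simp add: ideal_IQ_def nc.span_zero add.assoc add.commute)+
  show "a - b = a + - b" by (rule minus_ncq_def)
qed

end

lift_definition ncq_scale :: "rat \<Rightarrow> ncq \<Rightarrow> ncq" is nc_scale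
  unfolding ideal_IQ_def by (metis nc.scale_right_diff_distrib nc.span_scale)

global_interpretation ncq: vector_space ncq_scale
  by standard (transfer; simp add: ideal_IQ_def nc.span_zero nc.scale_right_distrib nc.scale_left_distrib)+

text \<open>The homogeneous component of degree \<open>n\<close> of \<open>\<rat> \<otimes> NC\<close>.\<close>

definition nc_degree :: "nat \<Rightarrow> (composition \<Rightarrow>\<^sub>0 rat) set"
  where "nc_degree n = nc.span {S \<alpha> | \<alpha>. weight \<alpha> = n}"

text \<open>
  The graded dual of the quotient is the direct sum of the duals of its components, i.e. the
  functionals that vanish on all but finitely many components.
\<close>

definition graded_dual :: "(ncq \<Rightarrow> rat) set"
  where "graded_dual = {\<phi>. Vector_Spaces.linear ncq_scale (*) \<phi> \<and>
           finite {n. \<exists>x \<in> nc_degree n. \<phi> (proj x) \<noteq> 0}}"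


section \<open>Quasi-symmetric functions\<close>

text \<open>
  A formal power series in variables indexed by \<open>nat\<close> is the function that sends an exponent
  vector to its coefficient.
\<close>

type_synonym 'a series = "(nat \<Rightarrow>\<^sub>0 nat) \<Rightarrow> 'a"

definition series_scale :: "'a::comm_ring_1 \<Rightarrow> 'a series \<Rightarrow> 'a series"
  where "series_scale c f = (\<lambda>e. c * f e)"

global_interpretation series: module series_scale
  by standard (simp_all add: series_scale_def fun_eq_iff algebra_simps)

text \<open>The exponent vector of the product of the \<open>z\<^bsub>i\<^esub>\<close> to the power \<open>\<alpha>\<^sub>j\<close>, \<open>i\<close> being the \<open>j\<close>-th entry of \<open>is\<close>.\<close>

definition exponent :: "nat list \<Rightarrow> composition \<Rightarrow> (nat \<Rightarrow>\<^sub>0 nat)"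
  where "exponent is \<alpha> = (\<Sum>j<len \<alpha>. Poly_Mapping.single (is ! j) (parts \<alpha> ! j))"

text \<open>
  As all parts are positive, different increasing sequences of variables give different monomials,
  so every coefficient of \<open>M \<alpha>\<close> is 0 or 1.
\<close>

definition M :: "composition \<Rightarrow> 'a::comm_ring_1 series"
  where "M \<alpha> = (\<lambda>e. of_bool (\<exists>is. length is = len \<alpha> \<and> sorted_wrt (<) is \<and> e = exponent is \<alpha>))"

lemma lookup_exponent:
  assumes "sorted_wrt (<) is" "length is = len \<alpha>" "k < len \<alpha>"
  shows "Poly_Mapping.lookup (exponent is \<alpha>) (is ! k) = parts \<alpha> ! k"
proof -
  have "distinct is" using assms(1) by (simp add: strict_sorted_iff)
  then have "Poly_Mapping.lookup (exponent is \<alpha>) (is ! k) =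
      (\<Sum>j<len \<alpha>. if j = k then parts \<alpha> ! k else 0)"
    unfolding exponent_def lookup_sum lookup_single using assms
    by (intro sum.cong) (auto simp: when_def nth_eq_iff_index_eq)
  then show ?thesis using assms(3) by simp
qed

lemma keys_exponent:
  assumes "sorted_wrt (<) is" "length is = len \<alpha>"
  shows "Poly_Mapping.keys (exponent is \<alpha>) = set is"
proof (intro equalityI subsetI)
  fix v assume "v \<in> Poly_Mapping.keys (exponent is \<alpha>)"
  then have "(\<Sum>j<len \<alpha>. (parts \<alpha> ! j when is ! j = v)) \<noteq> 0"
    by (simp add: in_keys_iff exponent_def lookup_sum lookup_single)
  then obtain j where "j < len \<alpha>" "is ! j = v"
    by (rule sum.not_neutral_contains_not_neutral) (auto simp: when_def split: if_splits)
  then show "v \<in> set is" using assms by auto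
next
  fix v assume "v \<in> set is"
  then obtain k where "k < len \<alpha>" "v = is ! k" using assms by (auto simp: in_set_conv_nth)
  moreover from this have "parts \<alpha> ! k \<in> set (parts \<alpha>)" by (simp add: len_def)
  then have "parts \<alpha> ! k \<noteq> 0" using parts_pos[of \<alpha>] by metis
  ultimately show "v \<in> Poly_Mapping.keys (exponent is \<alpha>)"
    using lookup_exponent[OF assms] by (simp add: in_keys_iff)
qed

text \<open>The nonzero exponents of a monomial, in the order of the variables.\<close>

definition shape :: "(nat \<Rightarrow>\<^sub>0 nat) \<Rightarrow> nat list"
  where "shape e = map (Poly_Mapping.lookup e) (sorted_list_of_set (Poly_Mapping.keys e))"

lemma shape_exponent:
  assumes "sorted_wrt (<) is" "length is = len \<alpha>"
  shows "shape (exponent is \<alpha>) = parts \<alpha>"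
proof -
  have "sorted_list_of_set (set is) = is"
    using assms(1) by (simp add: strict_sorted_iff sorted_list_of_set.idem_if_sorted_distinct)
  then show ?thesis
    unfolding shape_def keys_exponent[OF assms]
    using lookup_exponent[OF assms] assms(2) by (auto simp: len_def intro!: nth_equalityI)
qed

lemma exponent_shape:
  "\<exists>\<alpha> is. parts \<alpha> = shape e \<and> length is = len \<alpha> \<and> sorted_wrt (<) is \<and> e = exponent is \<alpha>"
proof -
  define js where "js = sorted_list_of_set (Poly_Mapping.keys e)"
  define \<alpha> where "\<alpha> = Composition (shape e)"
  have set_js: "set js = Poly_Mapping.keys e" by (simp add: js_def)
  have "0 \<notin> set (shape e)" by (auto simp: shape_def in_keys_iff)
  then have parts_\<alpha>: "parts \<alpha> = shape e" by (simp add: \<alpha>_def Composition_inverse)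
  then have length_js: "length js = len \<alpha>" by (simp add: len_def shape_def js_def)
  have sorted: "sorted_wrt (<) js" unfolding js_def by (rule strict_sorted_list_of_set)
  have "e = exponent js \<alpha>"
  proof (rule poly_mapping_eqI)
    fix v
    show "Poly_Mapping.lookup e v = Poly_Mapping.lookup (exponent js \<alpha>) v"
    proof (cases "v \<in> set js")
      case True
      then obtain k where k: "k < len \<alpha>" "v = js ! k" using length_js by (auto simp: in_set_conv_nth)
      then show ?thesis
        unfolding k(2) lookup_exponent[OF sorted length_js k(1)] parts_\<alpha>
        using length_js by (simp add: shape_def flip: js_def)
    next
      case False
      then have "v \<notin> Poly_Mapping.keys (exponent js \<alpha>)"
        unfolding keys_exponent[OF sorted length_js] .
      with False show ?thesis unfolding set_js by (simp add: in_keys_iff)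
    qed
  qed
  with parts_\<alpha> length_js sorted show ?thesis by blast
qed

lemma M_shape: "M \<alpha> e = of_bool (shape e = parts \<alpha>)"
proof -
  have "(\<exists>is. length is = len \<alpha> \<and> sorted_wrt (<) is \<and> e = exponent is \<alpha>) \<longleftrightarrow> shape e = parts \<alpha>"
    using shape_exponent exponent_shape[of e] by (auto simp: parts_inject)
  then show ?thesis by (simp add: M_def)
qed

definition qsym :: "int series set"
  where "qsym = series.span (range M)"

definition qsymQ :: "rat series set"
  where "qsymQ = series.span ((\<lambda>f e. rat_of_int (f e)) ` qsym)"

text \<open>
  The bilinear pairing for which \<open>M \<alpha>\<close> and \<open>S \<beta>\<close> are dual bases (see \<open>pairing_M_S\<close>): the coefficient
  of \<open>M \<alpha>\<close> in a quasi-symmetric function is its coefficient at \<open>z\<^sub>0\<^bsup>\<alpha>1\<^esup> z\<^sub>1\<^bsup>\<alpha>2\<^esup> ...\<close>, and the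
  coefficient of \<open>S \<alpha>\<close> in \<open>x\<close> is \<open>lookup x \<alpha>\<close> (see \<open>S_eq_single\<close>).
\<close>

definition pairing :: "rat series \<Rightarrow> (composition \<Rightarrow>\<^sub>0 rat) \<Rightarrow> rat"
  where "pairing f x =
    (\<Sum>\<alpha>\<in>Poly_Mapping.keys x. f (exponent [0..<len \<alpha>] \<alpha>) * Poly_Mapping.lookup x \<alpha>)"

lemma pairing_S: "pairing f (S \<alpha>) = f (exponent [0..<len \<alpha>] \<alpha>)"
  by (simp add: pairing_def S_eq_single)

lemma pairing_M_S: "pairing (M \<alpha>) (S \<beta>) = of_bool (\<alpha> = \<beta>)"
  by (auto simp: pairing_S M_shape shape_exponent parts_inject)

definition annihilator :: "rat series set"
  where "annihilator = {f \<in> qsymQ. \<forall>x \<in> ideal_IQ. pairing f x = 0}"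

text \<open>
  The transpose of the projection onto the quotient, as a map into quasi-symmetric functions; the
  element described exists and is unique for every member of the graded dual (see \<open>transpose_ex1\<close>).
\<close>

definition transpose_proj :: "(ncq \<Rightarrow> rat) \<Rightarrow> rat series"
  where "transpose_proj \<phi> = (THE f. f \<in> qsymQ \<and> (\<forall>x. pairing f x = \<phi> (proj x)))"


lemma qsymQ_shape:
  assumes "f \<in> qsymQ" "shape e = shape e'"
  shows "f e = f e'"
proof -
  have int: "g e = g e'" if "g \<in> qsym" for g
    using that unfolding qsym_def
    by (induction rule: series.span_induct_alt) (auto simp: series_scale_def M_shape assms(2))
  show ?thesis
    using assms(1) unfolding qsymQ_def
    by (induction rule: series.span_induct_alt) (auto simp: series_scale_def int)
qed

lemma M_in_qsymQ: "M \<alpha> \<in> qsymQ"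
proof -
  have "M \<alpha> = (\<lambda>e. rat_of_int (M \<alpha> e))" by (simp add: M_def fun_eq_iff)
  moreover have "M \<alpha> \<in> qsym" unfolding qsym_def by (rule series.span_base) simp
  ultimately show ?thesis unfolding qsymQ_def by (intro series.span_base image_eqI)
qed

lemma proj_linear: "Vector_Spaces.linear nc_scale ncq_scale proj"
  unfolding Vector_Spaces.linear_iff
  by (simp add: vector_space_def nc.scale_right_distrib nc.scale_left_distrib ncq.vector_space_axioms
      ncq.scale_right_distrib ncq.scale_left_distrib plus_ncq.abs_eq ncq_scale.abs_eq)

lemma nc_expand: "x = (\<Sum>\<alpha>\<in>Poly_Mapping.keys x. nc_scale (Poly_Mapping.lookup x \<alpha>) (S \<alpha>))"
proof (rule poly_mapping_eqI)
  fix \<beta>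
  show "Poly_Mapping.lookup x \<beta> = Poly_Mapping.lookup
      (\<Sum>\<alpha>\<in>Poly_Mapping.keys x. nc_scale (Poly_Mapping.lookup x \<alpha>) (S \<alpha>)) \<beta>"
    by (simp add: lookup_sum nc_scale_def S_eq_single mult_single lookup_single when_def in_keys_iff)
qed

lemma transpose_ex1:
  assumes "\<phi> \<in> graded_dual"
  shows "\<exists>!f. f \<in> qsymQ \<and> (\<forall>x. pairing f x = \<phi> (proj x))"
proof (rule ex_ex1I)
  define c where "c \<alpha> = \<phi> (proj (S \<alpha>))" for \<alpha>
  define D where "D = {n. \<exists>x \<in> nc_degree n. \<phi> (proj x) \<noteq> 0}"
  define A where "A = {\<alpha>. c \<alpha> \<noteq> 0}"
  define f where "f = (\<Sum>\<alpha>\<in>A. series_scale (c \<alpha>) (M \<alpha>))"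
  have lin: "Vector_Spaces.linear ncq_scale (*) \<phi>" and "finite D"
    using assms by (auto simp: graded_dual_def D_def)
  have "weight \<alpha> \<in> D" if "\<alpha> \<in> A" for \<alpha>
    using that nc.span_base[of "S \<alpha>" "{S \<beta> | \<beta>. weight \<beta> = weight \<alpha>}"]
    by (auto simp: A_def D_def c_def nc_degree_def)
  then have "A \<subseteq> (\<Union>n\<in>D. {\<alpha>. weight \<alpha> = n})" by auto
  then have "finite A"
    by (rule finite_subset) (simp add: \<open>finite D\<close> finite_weight)
  have "f \<in> qsymQ"
    unfolding f_def qsymQ_def
    by (intro series.span_sum series.span_scale M_in_qsymQ[unfolded qsymQ_def])
  moreover have "pairing f x = \<phi> (proj x)" for x
  proof -
    interpret l: Vector_Spaces.linear nc_scale "(*)" "\<phi> \<circ> proj"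
      using Vector_Spaces.linear_compose[OF proj_linear lin] .
    have "f (exponent [0..<len \<alpha>] \<alpha>) = c \<alpha>" for \<alpha>
    proof -
      have app: "(\<Sum>\<beta>\<in>B. g \<beta>) e = (\<Sum>\<beta>\<in>B. g \<beta> e)" for B and g :: "composition \<Rightarrow> rat series" and e
        by (induction B rule: infinite_finite_induct) auto
      have "f (exponent [0..<len \<alpha>] \<alpha>) = (\<Sum>\<beta>\<in>A. if \<beta> = \<alpha> then c \<alpha> else 0)"
        unfolding f_def app
        by (intro sum.cong) (auto simp: series_scale_def M_shape shape_exponent parts_inject)
      then show ?thesis using \<open>finite A\<close> by (simp add: A_def)
    qed
    then have "pairing f x = (\<Sum>\<alpha>\<in>Poly_Mapping.keys x. Poly_Mapping.lookup x \<alpha> * (\<phi> \<circ> proj) (S \<alpha>))"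
      by (simp add: pairing_def c_def mult.commute)
    also have "\<dots> = (\<phi> \<circ> proj) (\<Sum>\<alpha>\<in>Poly_Mapping.keys x. nc_scale (Poly_Mapping.lookup x \<alpha>) (S \<alpha>))"
      by (simp only: l.sum l.scale)
    finally show ?thesis by (simp flip: nc_expand)
  qed
  ultimately show "\<exists>f. f \<in> qsymQ \<and> (\<forall>x. pairing f x = \<phi> (proj x))" by blast
next
  fix f g assume f: "f \<in> qsymQ \<and> (\<forall>x. pairing f x = \<phi> (proj x))"
    and g: "g \<in> qsymQ \<and> (\<forall>x. pairing g x = \<phi> (proj x))"
  show "f = g"
  proof
    fix e
    obtain \<alpha> where "parts \<alpha> = shape e" using exponent_shape by blast
    then have e: "shape e = shape (exponent [0..<len \<alpha>] \<alpha>)" by (simp add: shape_exponent)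
    have "f e = pairing f (S \<alpha>)" unfolding pairing_S using f e by (blast intro: qsymQ_shape)
    also have "\<dots> = pairing g (S \<alpha>)" using f g by simp
    also have "\<dots> = g e" unfolding pairing_S using g e by (metis qsymQ_shape)
    finally show "f e = g e" .
  qed
qed


section \<open>The peak algebra\<close>

definition \<theta> :: "composition \<Rightarrow> int series"
  where "\<theta> \<alpha> = (\<Sum>\<beta> | weight \<beta> = weight \<alpha> \<and> star \<beta> \<preceq> \<alpha>. series_scale (2 ^ len \<beta>) (M \<beta>))"

definition peak_algebra :: "int series set"
  where "peak_algebra = series.span {\<theta> \<alpha> | \<alpha>. peak_composition \<alpha>}"

definition peak_algebraQ :: "rat series set"
  where "peak_algebraQ = series.span ((\<lambda>f e. rat_of_int (f e)) ` peak_algebra)"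

end

(*
  Refinement of compositions is inclusion of their sets D of partial sums, and beta* refines alpha
  iff D(alpha) is contained in D(beta) together with D(beta) + 1. With this description a direct
  sign cancellation shows that peak functions annihilate the ideal.

  Conversely, modulo the ideal every word is a combination of sparse words, those in which all
  letters but the first have degree at least 2. Raising the first part of a sparse composition by
  one and lowering the last part by one gives a peak composition, and the matrix of the resulting
  peak functions on the sparse words is triangular with respect to the sum of all partial sums.
  Hence some combination of peak functions agrees with a given functional annihilating the ideal
  on all sparse words, and therefore everywhere.
*)
theory Submission
  imports Defs
begin

section \<open>Refinement and partial sums\<close>

primrec partial_sums :: "nat list \<Rightarrow> nat set" where
  "partial_sums [] = {}"
| "partial_sums (x # xs) = insert x ((+) x ` partial_sums xs)"

lemma partial_sums_append:
  "partial_sums (xs @ ys) = partial_sums xs \<union> (+) (sum_list xs) ` partial_sums ys"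
  by (induction xs) (auto simp: image_Un image_image add.assoc)

lemma finite_partial_sums: "finite (partial_sums xs)"
  by (induction xs) auto

lemma partial_sums_le: "d \<in> partial_sums xs \<Longrightarrow> d \<le> sum_list xs"
  by (induction xs arbitrary: d) auto

lemma partial_sums_pos: "0 \<notin> set xs \<Longrightarrow> d \<in> partial_sums xs \<Longrightarrow> 0 < d"
  by (induction xs arbitrary: d) auto

lemma sum_list_in_partial_sums: "xs \<noteq> [] \<Longrightarrow> sum_list xs \<in> partial_sums xs"
proof (induction xs)
  case (Cons x xs)
  then show ?case by (cases "xs = []") auto
qed simp

lemma partial_sums_split:
  "d \<in> partial_sums xs \<Longrightarrow> \<exists>ys zs. xs = ys @ zs \<and> sum_list ys = d"
proof (induction xs arbitrary: d)
  case (Cons x xs)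
  show ?case
  proof (cases "d = x")
    case True
    then have "x # xs = [x] @ xs \<and> sum_list [x] = d" by simp
    then show ?thesis by blast
  next
    case False
    then obtain e where e: "e \<in> partial_sums xs" "d = x + e" using Cons.prems by auto
    then obtain ys zs where "xs = ys @ zs" "sum_list ys = e" using Cons.IH by blast
    with e have "x # xs = (x # ys) @ zs \<and> sum_list (x # ys) = d" by simp
    then show ?thesis by blast
  qed
qed simp

text \<open>Positivity makes the first part the least partial sum, so the list is recovered part by
  part.\<close>

lemma partial_sums_inj:
  assumes "0 \<notin> set xs" "0 \<notin> set ys" "partial_sums xs = partial_sums ys"
  shows "xs = ys"
  using assms
proof (induction xs arbitrary: ys)
  case Nil
  then show ?case by (cases ys) auto
next
  case (Cons x xs)
  then obtain y zs where ys: "ys = y # zs" by (cases ys) auto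
  have px: "\<And>d. d \<in> partial_sums xs \<Longrightarrow> 0 < d" and pz: "\<And>d. d \<in> partial_sums zs \<Longrightarrow> 0 < d"
    using Cons.prems partial_sums_pos ys by auto
  have eq: "insert x ((+) x ` partial_sums xs) = insert y ((+) y ` partial_sums zs)"
    using Cons.prems ys by simp
  have "x \<in> insert y ((+) y ` partial_sums zs)" "y \<in> insert x ((+) x ` partial_sums xs)"
    using eq by blast+
  then have xy: "x = y" by auto
  have "x \<notin> (+) x ` partial_sums xs" "x \<notin> (+) x ` partial_sums zs" using px pz by fastforce+
  then have "(+) x ` partial_sums xs = (+) x ` partial_sums zs"
    using eq xy by (simp add: insert_ident)
  then have "partial_sums xs = partial_sums zs" by (simp add: inj_image_eq_iff)
  with Cons ys xy show ?case by simp
qed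

text \<open>Each block ends at a partial sum of \<open>bs\<close>. Conversely, the first part of
  \<open>as\<close> is a partial sum of \<open>bs\<close> and cuts off the first block; larger
  partial sums belong to the rest. Equal totals leave nothing over at the end.\<close>

lemma blocks_iff_partial_sums:
  assumes "0 \<notin> set as" "0 \<notin> set bs" "sum_list as = sum_list bs"
  shows "(\<exists>bss. concat bss = bs \<and> map sum_list bss = as) \<longleftrightarrow> partial_sums as \<subseteq> partial_sums bs"
proof
  have "partial_sums (map sum_list bss) \<subseteq> partial_sums (concat bss)"
    if "0 \<notin> set (map sum_list bss)" for bss :: "nat list list"
    using that
  proof (induction bss)
    case (Cons b bss)
    then have "sum_list b \<in> partial_sums b" by (intro sum_list_in_partial_sums) auto
    with Cons show ?case by (auto simp: partial_sums_append)
  qed simp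
  with assms(1) show "\<exists>bss. concat bss = bs \<and> map sum_list bss = as \<Longrightarrow> partial_sums as \<subseteq> partial_sums bs"
    by blast
next
  show "partial_sums as \<subseteq> partial_sums bs \<Longrightarrow> \<exists>bss. concat bss = bs \<and> map sum_list bss = as"
    using assms
  proof (induction as arbitrary: bs)
    case Nil
    then have "bs = []" by (cases bs) auto
    then show ?case by (intro exI[of _ "[]"]) simp
  next
    case (Cons a as)
    then obtain ys zs where bs: "bs = ys @ zs" "sum_list ys = a"
      using partial_sums_split[of a bs] by auto
    have "partial_sums as \<subseteq> partial_sums zs"
    proof
      fix d assume d: "d \<in> partial_sums as"
      then have "a + d \<in> partial_sums ys \<union> (+) a ` partial_sums zs"
        using Cons.prems(1) bs by (auto simp: partial_sums_append)
      moreover have "0 < d" using d Cons.prems partial_sums_pos by auto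
      ultimately show "d \<in> partial_sums zs" using partial_sums_le[of "a + d" ys] bs by auto
    qed
    then obtain bss where "concat bss = zs" "map sum_list bss = as"
      using Cons.IH[of zs] Cons.prems bs by auto
    then show ?case using bs by (intro exI[of _ "ys # bss"]) simp
  qed
qed

text \<open>Splitting a part c as 1, c - 1 inserts the successor of the preceding partial sum. The
  first part stays whole, so 1 is not forced in; the bound excludes the successor of the
  total.\<close>

lemma partial_sums_star_list:
  assumes "0 \<notin> set bs"
  shows "partial_sums (star_list bs) =
    partial_sums bs \<union> {d \<in> Suc ` partial_sums bs. d \<le> sum_list bs}"
proof -
  \<comment> \<open>In the tail the leading part is split too, so 0 counts as a preceding partial
    sum.\<close>
  have tail: "partial_sums (concat (map (\<lambda>c. if c > 1 then [1, c - 1] else [c]) cs)) =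
      partial_sums cs \<union> {d \<in> Suc ` insert 0 (partial_sums cs). d \<le> sum_list cs}"
    if "0 \<notin> set cs" for cs :: "nat list"
    using that
  proof (induction cs)
    case (Cons c cs)
    have ps: "partial_sums ((if c > 1 then [1, c - 1] else [c]) @ ds)
        = {1, c} \<union> (+) c ` partial_sums ds" for ds
      using Cons.prems by (auto simp: image_image image_iff)
    show ?case using Cons.prems Cons.IH unfolding list.map concat.simps ps
      by (auto simp: image_iff)
  qed auto
  show ?thesis
  proof (cases bs)
    case (Cons c cs)
    with assms have "0 \<notin> set cs" by simp
    then show ?thesis unfolding Cons star_list.simps partial_sums.simps tail[OF \<open>0 \<notin> set cs\<close>]
      by (auto simp: image_iff)
  qed simp
qed

text \<open>Adjacent partial sums are separated by a part 1, which can only be the last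
  part.\<close>

lemma peak_partial_sums:
  assumes "\<forall>b \<in> set (butlast xs). b > 1" "0 \<notin> set xs"
  shows "d \<in> partial_sums xs \<Longrightarrow> Suc d \<in> partial_sums xs \<Longrightarrow> Suc d = sum_list xs"
    and "1 \<in> partial_sums xs \<Longrightarrow> sum_list xs = 1"
proof -
  \<comment> \<open>The claims need a joint induction: adjacency at the first part \<open>x\<close>
    means that 1 is a partial sum of the tail.\<close>
  have "(\<forall>d. d \<in> partial_sums xs \<longrightarrow> Suc d \<in> partial_sums xs \<longrightarrow> Suc d = sum_list xs) \<and>
    (1 \<in> partial_sums xs \<longrightarrow> sum_list xs = 1)"
    using assms
  proof (induction xs)
    case (Cons x xs)
    show ?case
    proof (cases "xs = []")
      case False
      with Cons have x: "x > 1" and IH: "\<And>d. d \<in> partial_sums xs \<Longrightarrow> Suc d \<in> partial_sums xs \<Longrightarrow> Suc d = sum_list xs"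
        "1 \<in> partial_sums xs \<Longrightarrow> sum_list xs = 1" by auto
      have pos: "0 \<notin> partial_sums xs" using partial_sums_pos[of xs 0] Cons.prems by auto
      show ?thesis using x IH pos by (auto simp flip: add_Suc_right)
    qed simp
  qed simp
  then show "d \<in> partial_sums xs \<Longrightarrow> Suc d \<in> partial_sums xs \<Longrightarrow> Suc d = sum_list xs"
    and "1 \<in> partial_sums xs \<Longrightarrow> sum_list xs = 1" by blast+
qed

section \<open>Compositions encoded by their partial sums\<close>

definition psums :: "composition \<Rightarrow> nat set"
  where "psums \<alpha> = partial_sums (parts \<alpha>)"

text \<open>\<open>letter 0\<close> is the empty word, matching h_0 = 1, so the end terms of
  \<open>X n\<close> have the same form as the others.\<close>

lift_definition letter :: "nat \<Rightarrow> composition" is "\<lambda>k. if k = 0 then [] else [k]"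
  by auto

lemma letter_0 [simp]: "letter 0 = 0"
  by transfer simp

lemma weight_simps [simp]:
  "weight 0 = 0" "weight (\<alpha> + \<beta>) = weight \<alpha> + weight \<beta>" "weight (letter k) = k"
  by (simp_all add: weight_def zero_composition.rep_eq plus_composition.rep_eq letter.rep_eq)

lemma len_simps [simp]:
  "len 0 = 0" "len (\<alpha> + \<beta>) = len \<alpha> + len \<beta>" "len (letter k) = of_bool (k \<noteq> 0)"
  by (simp_all add: len_def zero_composition.rep_eq plus_composition.rep_eq letter.rep_eq)

lemma psums_simps [simp]:
  "psums 0 = {}" "psums (\<alpha> + \<beta>) = psums \<alpha> \<union> (+) (weight \<alpha>) ` psums \<beta>"
  "psums (letter k) = (if k = 0 then {} else {k})"
  by (simp_all add: psums_def weight_def partial_sums_append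
      zero_composition.rep_eq plus_composition.rep_eq letter.rep_eq)

lemma weight_in_psums: "weight \<alpha> > 0 \<Longrightarrow> weight \<alpha> \<in> psums \<alpha>"
  unfolding weight_def psums_def by (rule sum_list_in_partial_sums) auto

lemma psums_bounds: "d \<in> psums \<alpha> \<Longrightarrow> 0 < d \<and> d \<le> weight \<alpha>"
  using partial_sums_pos partial_sums_le parts_pos unfolding weight_def psums_def by blast

lemma psums_inj: "psums \<alpha> = psums \<beta> \<Longrightarrow> \<alpha> = \<beta>"
  using partial_sums_inj[OF parts_pos parts_pos] by (simp add: psums_def parts_inject)

text \<open>The bound in \<open>partial_sums_star_list\<close> disappears because partial sums of
  \<open>\<alpha>\<close> never exceed the common weight.\<close>

lemma star_refines_iff:
  assumes "weight \<beta> = weight \<alpha>"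
  shows "star \<beta> \<preceq> \<alpha> \<longleftrightarrow> psums \<alpha> \<subseteq> psums \<beta> \<union> Suc ` psums \<beta>"
proof -
  have sum: "sum_list (star_list xs) = sum_list xs" if "0 \<notin> set xs" for xs
  proof -
    have "sum_list (concat (map (\<lambda>c. if c > 1 then [1, c - 1] else [c]) ys)) = sum_list ys" for ys :: "nat list"
      by (induction ys) auto
    then show ?thesis by (cases xs) auto
  qed
  have "star \<beta> \<preceq> \<alpha> \<longleftrightarrow> partial_sums (parts \<alpha>) \<subseteq> partial_sums (star_list (parts \<beta>))"
    unfolding refines_def using assms
    by (subst blocks_iff_partial_sums[OF parts_pos parts_pos])
      (auto simp: star.rep_eq sum parts_pos weight_def)
  also have "\<dots> \<longleftrightarrow> psums \<alpha> \<subseteq> psums \<beta> \<union> Suc ` psums \<beta>"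
    using psums_bounds[of _ \<alpha>] assms
    unfolding partial_sums_star_list[OF parts_pos] psums_def weight_def by auto
  finally show ?thesis .
qed

lemma composition_cases:
  obtains "\<beta> = 0" | \<gamma> a where "\<beta> = \<gamma> + letter a" "a \<ge> 1"
proof (cases "parts \<beta>" rule: rev_cases)
  case Nil
  then have "\<beta> = 0" by (metis parts_inject zero_composition.rep_eq)
  then show ?thesis using that by blast
next
  case (snoc xs a)
  then have pos: "0 \<notin> set xs" "a \<noteq> 0" using parts_pos[of \<beta>] by auto
  then have "parts \<beta> = parts (Composition xs + letter a)"
    using snoc by (simp add: plus_composition.rep_eq letter.rep_eq Composition_inverse)
  then show ?thesis using that pos by (metis parts_inject less_one not_le)
qed

section \<open>Functionals that vanish on the ideal\<close>

text \<open>
  \<open>F\<close> is the table of values of a linear functional on the basis \<open>S\<close>; the condition says that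
  the functional vanishes on all products \<open>S \<gamma> * X n * S \<delta>\<close>.
\<close>

definition kills :: "(composition \<Rightarrow> rat) \<Rightarrow> bool"
  where "kills F \<longleftrightarrow> (\<forall>\<gamma> \<delta>. \<forall>n\<ge>1.
    (\<Sum>i\<le>2 * n. (- 1) ^ i * F (\<gamma> + letter i + letter (2 * n - i) + \<delta>)) = 0)"

definition sparse :: "composition \<Rightarrow> bool"
  where "sparse \<beta> \<longleftrightarrow> (\<forall>b \<in> set (tl (parts \<beta>)). b > 1)"

lemma sparse_0: "sparse 0"
  by (simp add: sparse_def zero_composition.rep_eq)

lemma sparse_letter: "sparse (letter a)"
  by (simp add: sparse_def letter.rep_eq)

lemma sparse_snoc: "sparse \<gamma> \<Longrightarrow> a > 1 \<Longrightarrow> sparse (\<gamma> + letter a)"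
  by (cases "parts \<gamma>") (auto simp: sparse_def letter.rep_eq plus_composition.rep_eq)

text \<open>
  Modulo the ideal, letters of degree 1 can be moved to the front of a word: for odd \<open>j\<close>, the
  relation in degree \<open>j + 1\<close> expresses \<open>h j * h 1\<close> by products whose last letter has degree
  at least 2; for even \<open>j\<close>, the relation in degree \<open>j\<close> replaces \<open>h j\<close> in front of \<open>h 1\<close>
  by products with a last letter of smaller degree. Thus sparse words span the quotient.
\<close>

lemma kills_sparse_zero:
  assumes "kills F" "\<And>\<beta>. sparse \<beta> \<Longrightarrow> F \<beta> = 0"
  shows "F \<beta> = 0"
  using assms
proof (induction "weight \<beta>" arbitrary: F \<beta> rule: less_induct)
  case less
  \<comment> \<open>Appending a fixed last letter to all words gives a functional that again
    satisfies \<open>kills\<close>, and a letter above 1 keeps sparse words sparse. This is why the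
    induction ranges over \<open>F\<close> too.\<close>
  have big: "F (\<gamma> + letter a) = 0" if "a > 1" "weight \<gamma> + a = weight \<beta>" for \<gamma> a
  proof (rule less.hyps[where F = "\<lambda>\<gamma>. F (\<gamma> + letter a)"])
    show "kills (\<lambda>\<gamma>. F (\<gamma> + letter a))"
      unfolding kills_def
    proof (intro allI impI)
      fix \<gamma> \<delta> and n :: nat assume "n \<ge> 1"
      then show "(\<Sum>i\<le>2 * n. (- 1) ^ i * F (\<gamma> + letter i + letter (2 * n - i) + \<delta> + letter a)) = 0"
        using less.prems(1)[unfolded kills_def, rule_format, of n \<gamma> "\<delta> + letter a"]
        by (simp add: add.assoc)
    qed
  qed (use that less.prems sparse_snoc in auto)
  have one: "F (\<gamma> + letter j + letter 1) = 0" if "j \<ge> 1" "weight \<gamma> + j + 1 = weight \<beta>" for \<gamma> j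
    using that
  proof (induction j arbitrary: \<gamma> rule: less_induct)
    case (less j)
    show ?case
    proof (cases "odd j")
      case True
      then obtain k where "j = 2 * k + 1" by (elim oddE)
      then obtain n where n: "j + 1 = 2 * n" "n \<ge> 1" by (intro that[of "k + 1"]) auto
      have "0 = (\<Sum>i\<le>2 * n. (- 1) ^ i * F (\<gamma> + letter i + letter (2 * n - i) + 0))"
        using \<open>kills F\<close> n by (simp only: kills_def)
      also have "\<dots> = (\<Sum>i\<le>2 * n. if i = j then - F (\<gamma> + letter j + letter 1) else 0)"
      proof (rule sum.cong[OF refl])
        fix i assume i: "i \<in> {..2 * n}"
        show "(- 1) ^ i * F (\<gamma> + letter i + letter (2 * n - i) + 0)
          = (if i = j then - F (\<gamma> + letter j + letter 1) else 0)"
        proof (cases "i = j")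
          case True
          then show ?thesis using \<open>odd j\<close> by (simp flip: n(1))
        next
          case False
          \<comment> \<open>For \<open>i = j + 1\<close> the second letter is empty, so the word
            ends in \<open>j + 1\<close>, which exceeds 1.\<close>
          then consider "i = j + 1" | "j + 1 - i > 1" "i \<le> j" using i n by fastforce
          then show ?thesis
          proof cases
            case 1
            then show ?thesis using n less.prems big[of "j + 1" \<gamma>] by simp
          next
            case 2
            then show ?thesis using less.prems big[of "j + 1 - i" "\<gamma> + letter i"] False by (simp flip: n(1))
          qed
        qed
      qed
      also have "\<dots> = - F (\<gamma> + letter j + letter 1)" using n by simp
      finally show ?thesis by simp
    next
      case False
      then obtain n where n: "j = 2 * n" "n \<ge> 1" using less.prems by auto
      have "0 = (\<Sum>i\<le>2 * n. (- 1) ^ i * F (\<gamma> + letter i + letter (2 * n - i) + letter 1))"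
        using \<open>kills F\<close> n by (simp only: kills_def)
      \<comment> \<open>The ends \<open>i = 0\<close> and \<open>i = j\<close> give the same word
        with sign +1; the terms between vanish by induction. The resulting factor 2 is cancelled
        over the rationals.\<close>
      also have "\<dots> = (\<Sum>i\<le>2 * n. if i \<in> {0, j} then F (\<gamma> + letter j + letter 1) else 0)"
      proof (rule sum.cong[OF refl])
        fix i assume i: "i \<in> {..2 * n}"
        show "(- 1) ^ i * F (\<gamma> + letter i + letter (2 * n - i) + letter 1)
          = (if i \<in> {0, j} then F (\<gamma> + letter j + letter 1) else 0)"
          using i less.IH[of "j - i" "\<gamma> + letter i"] less.prems False n by auto
      qed
      also have "\<dots> = 2 * F (\<gamma> + letter j + letter 1)"
        using n by (subst sum.inter_restrict[symmetric]) (auto simp: Int_absorb1)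
      finally show ?thesis by simp
    qed
  qed
  show ?case
  proof (cases \<beta> rule: composition_cases)
    case 1
    then show ?thesis using less.prems sparse_0 by simp
  next
    case (2 \<gamma> a)
    show ?thesis
    proof (cases "a > 1")
      case True
      then show ?thesis using big 2 by simp
    next
      case False
      then have a: "a = 1" using 2 by simp
      show ?thesis
      proof (cases \<gamma> rule: composition_cases)
        case 1
        then show ?thesis using less.prems 2 sparse_letter by simp
      next
        case (2 \<gamma>' j)
        then show ?thesis using one \<open>\<beta> = \<gamma> + letter a\<close> a by simp
      qed
    qed
  qed
qed

section \<open>Peak functions vanish on the ideal\<close>

definition theta_coeff :: "composition \<Rightarrow> composition \<Rightarrow> rat"
  where "theta_coeff \<alpha> \<beta> = of_bool (weight \<beta> = weight \<alpha> \<and> star \<beta> \<preceq> \<alpha>) * 2 ^ len \<beta>"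

text \<open>
  Let \<open>E\<close> consist of the partial sums of \<open>\<alpha>\<close> that are not covered by the partial sums \<open>B\<close> common
  to all terms. Splitting the block of size \<open>2 n\<close> at \<open>i\<close> covers \<open>p + i\<close> and \<open>p + i + 1\<close> in addition.
  If \<open>E\<close> is a singleton, exactly two consecutive \<open>i\<close> contribute and cancel; a larger \<open>E\<close> is never
  covered, as a peak composition has no adjacent partial sums except possibly at the top.
\<close>

lemma kills_theta_coeff:
  assumes "peak_composition \<alpha>"
  shows "kills (theta_coeff \<alpha>)"
  unfolding kills_def
proof (intro allI impI)
  fix \<gamma> \<delta> and n :: nat assume n: "n \<ge> 1"
  define t where "t i = \<gamma> + letter i + letter (2 * n - i) + \<delta>" for i
  define p where "p = weight \<gamma>"
  define K where "K = len \<gamma> + len \<delta>"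
  \<comment> \<open>The end \<open>p + 2 * n\<close> of the block is a partial sum for every choice
    of \<open>i\<close>; only \<open>p + i\<close> varies.\<close>
  define B where "B = insert (p + 2 * n) (psums \<gamma> \<union> (+) (p + 2 * n) ` psums \<delta>)"
  define E where "E = psums \<alpha> - (B \<union> Suc ` B)"
  define mid where "mid i \<longleftrightarrow> 0 < i \<and> i < 2 * n" for i
  have weight_t: "weight (t i) = p + 2 * n + weight \<delta>" if "i \<le> 2 * n" for i
    using that by (simp add: t_def p_def)
  have len_t: "len (t i) = K + (if mid i then 2 else 1)" if "i \<le> 2 * n" for i
    using that n by (auto simp: t_def K_def mid_def)
  have psums_t: "psums (t i) = B \<union> (if mid i then {p + i} else {})" if "i \<le> 2 * n" for i
    using that n by (auto simp: t_def B_def p_def mid_def)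
  have sgn1: "(\<Sum>i\<le>2 * k. (- 1) ^ i) = (1 :: rat)" for k :: nat
    by (induction k) auto
  show "(\<Sum>i\<le>2 * n. (- 1) ^ i * theta_coeff \<alpha> (t i)) = 0"
  proof (cases "weight \<alpha> = p + 2 * n + weight \<delta>")
    case False
    then show ?thesis by (intro sum.neutral) (auto simp: theta_coeff_def weight_t)
  next
    case True
    have coeff: "theta_coeff \<alpha> (t i) =
        of_bool (E \<subseteq> (if mid i then {p + i, p + i + 1} else {})) * 2 ^ (K + (if mid i then 2 else 1))"
      if "i \<le> 2 * n" for i
    proof -
      have "star (t i) \<preceq> \<alpha> \<longleftrightarrow> E \<subseteq> (if mid i then {p + i, p + i + 1} else {})"
        unfolding star_refines_iff[OF weight_t[OF that, folded True]] psums_t[OF that] E_def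
        by auto
      then show ?thesis by (simp add: theta_coeff_def weight_t[OF that] True len_t[OF that])
    qed
    show ?thesis
    proof (cases "E = {}")
      case True
      \<comment> \<open>Every \<open>i\<close> contributes. The alternating sum of
        \<open>2 ^ (K + 2)\<close> equals \<open>2 ^ (K + 2)\<close>, and the two ends, whose words
        have one part fewer, fall short by \<open>2 ^ (K + 1)\<close> each.\<close>
      have "(\<Sum>i\<le>2 * n. (- 1) ^ i * theta_coeff \<alpha> (t i)) =
          (\<Sum>i\<le>2 * n. 2 ^ (K + 2) * (- 1) ^ i - (if i \<in> {0, 2 * n} then 2 ^ (K + 1) else 0))"
        using True n by (intro sum.cong) (auto simp: coeff mid_def)
      also have "\<dots> = 2 ^ (K + 2) - (\<Sum>i\<in>{0, 2 * n}. 2 ^ (K + 1))"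
        unfolding sum_subtractf
        by (subst sum.inter_restrict[symmetric]) (auto simp: sgn1 Int_absorb1 simp flip: sum_distrib_left)
      also have "\<dots> = 0" using n by simp
      finally show ?thesis .
    next
      case False
      then obtain e where e: "e \<in> E" by blast
      define good where "good i \<longleftrightarrow> mid i \<and> E \<subseteq> {p + i, p + i + 1}" for i
      have "(\<Sum>i\<le>2 * n. (- 1) ^ i * theta_coeff \<alpha> (t i)) =
          (\<Sum>i\<le>2 * n. if i \<in> {i. good i} then 2 ^ (K + 2) * (- 1) ^ i else 0)"
        using e by (intro sum.cong) (auto simp: coeff good_def)
      also have "\<dots> = (\<Sum>i\<in>{i. good i}. 2 ^ (K + 2) * (- 1) ^ i)"
        by (subst sum.inter_restrict[symmetric])
          (auto simp: good_def mid_def intro!: sum.cong)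
      also have "\<dots> = 0"
      proof (cases "{i. good i} = {}")
        case False
        then obtain i where "good i" by blast
        then have i: "mid i" "E \<subseteq> {p + i, p + i + 1}" by (auto simp: good_def)
        have peak: "\<And>d. d \<in> psums \<alpha> \<Longrightarrow> Suc d \<in> psums \<alpha> \<Longrightarrow> Suc d = weight \<alpha>"
          "1 \<in> psums \<alpha> \<Longrightarrow> weight \<alpha> = 1"
          using peak_partial_sums[OF assms[unfolded peak_composition_def] parts_pos]
          unfolding psums_def weight_def by blast+
        \<comment> \<open>In a peak composition only the total weight can be the successor of
          another partial sum. It lies in \<open>B\<close>, so \<open>E\<close> has no adjacent
          elements.\<close>
        have "weight \<alpha> \<in> B"
          using weight_in_psums[of "t 0"] True n by (simp add: weight_t psums_t mid_def)
        then have E_adj: "Suc d \<notin> E" if "d \<in> E" for d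
          using that peak(1)[of d] by (auto simp: E_def)
        \<comment> \<open>If \<open>p\<close> is in \<open>psums \<gamma>\<close>, then
          \<open>p + 1\<close> is already covered. Otherwise \<open>p = 0\<close>, and a partial sum
          1 forces total weight 1, less than \<open>2 * n\<close>.\<close>
        have "e \<noteq> p + 1"
        proof
          assume "e = p + 1"
          then have "p \<notin> psums \<gamma>" using e by (auto simp: E_def B_def)
          then have "p = 0" using weight_in_psums[of \<gamma>] by (auto simp: p_def)
          then show False using \<open>e = p + 1\<close> e peak(2) True n by (auto simp: E_def)
        qed
        moreover have "e \<noteq> p + 2 * n" using e by (auto simp: E_def B_def)
        ultimately have range: "p + 2 \<le> e" "e < p + 2 * n"
          using e i by (auto simp: mid_def)
        then obtain k where k: "e = p + k + 2" using nat_le_iff_add[of "p + 2" e] by auto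
        have "E = {e}"
          using i e E_adj by auto
        \<comment> \<open>\<open>e\<close> is \<open>p + i\<close> for \<open>i = k + 2\<close> and
          \<open>p + i + 1\<close> for \<open>i = k + 1\<close>. The bounds on \<open>e\<close> make
          both splits interior, and their signs are opposite.\<close>
        then have "{i. good i} = {k + 1, k + 2}"
          using k range by (auto simp: good_def mid_def)
        then show ?thesis by simp
      qed simp
      finally show ?thesis .
    qed
  qed
qed

section \<open>Sparse compositions and triangularity\<close>

lemma sparse_nonadjacent:
  assumes "sparse \<beta>" "d \<in> psums \<beta>"
  shows "Suc d \<notin> psums \<beta>"
proof -
  \<comment> \<open>The tail has all parts above 1, so measured from the end of the first part its
    partial sums start at 2 or later and keep distance at least 2.\<close>
  have big: "d \<in> partial_sums xs \<longrightarrow> d > 1 \<and> Suc d \<notin> partial_sums xs"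
    if "\<forall>b \<in> set xs. b > 1" for xs d
    using that
  proof (induction xs arbitrary: d)
    case (Cons x xs)
    then have "\<And>d. d \<in> partial_sums xs \<Longrightarrow> 1 < d \<and> Suc d \<notin> partial_sums xs" "x > 1" by auto
    then show ?case by (fastforce simp flip: add_Suc_right)
  qed simp
  show ?thesis
  proof (cases "parts \<beta>")
    case (Cons x xs)
    then have *: "\<And>d. d \<in> partial_sums xs \<Longrightarrow> 1 < d \<and> Suc d \<notin> partial_sums xs"
      using assms(1) big[of xs] by (simp add: sparse_def)
    then show ?thesis
      using assms(2) Cons by (fastforce simp: psums_def simp flip: add_Suc_right)
  qed (use assms in \<open>simp add: psums_def\<close>)
qed

text \<open>
  Moving one unit from the last part of a sparse composition to the first gives a peak composition.
\<close>

lemma sparse_to_peak: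
  assumes "sparse \<beta>"
  shows "\<exists>\<alpha>. peak_composition \<alpha> \<and> weight \<alpha> = weight \<beta> \<and>
    psums \<alpha> = Suc ` (psums \<beta> - {weight \<beta>}) \<union> psums \<beta> \<inter> {weight \<beta>}"
proof (cases "length (parts \<beta>) \<le> 1")
  case True
  then have "parts \<beta> = [] \<or> (\<exists>a. parts \<beta> = [a])" by (cases "parts \<beta>") auto
  \<comment> \<open>With at most one part there is no partial sum below the total, so
    \<open>\<beta>\<close> itself serves.\<close>
  then show ?thesis
    by (intro exI[of _ \<beta>]) (auto simp: peak_composition_def psums_def weight_def)
next
  case False
  then obtain a xs l where \<beta>: "parts \<beta> = a # xs @ [l]"
    by (cases "parts \<beta>"; cases "tl (parts \<beta>)" rule: rev_cases) auto
  then have pos: "a > 0" "l > 1" and big: "\<forall>b \<in> set xs. b > 1"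
    using parts_pos[of \<beta>] assms by (auto simp: sparse_def)
  define \<alpha> where "\<alpha> = Composition ((a + 1) # xs @ [l - 1])"
  have \<alpha>: "parts \<alpha> = (a + 1) # xs @ [l - 1]"
    unfolding \<alpha>_def using pos big by (intro Composition_inverse) auto
  have "peak_composition \<alpha>"
    using pos big by (auto simp: peak_composition_def \<alpha> butlast_append)
  moreover have w: "weight \<beta> = a + sum_list xs + l" "weight \<alpha> = weight \<beta>"
    using pos by (auto simp: weight_def \<alpha> \<beta>)
  moreover have "psums \<alpha> = Suc ` (psums \<beta> - {weight \<beta>}) \<union> psums \<beta> \<inter> {weight \<beta>}"
  proof -
    define P where "P = insert a ((+) a ` partial_sums xs)"
    have less: "d < weight \<beta>" if "d \<in> P" for d
      using that partial_sums_le[of _ xs] pos w by (fastforce simp: P_def)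
    have "psums \<beta> = insert (weight \<beta>) P"
      using w by (auto simp: psums_def \<beta> P_def partial_sums_append image_Un)
    moreover have "psums \<alpha> = insert (weight \<beta>) (Suc ` P)"
      using w pos by (auto simp: psums_def \<alpha> P_def partial_sums_append image_Un image_image)
    ultimately show ?thesis using less by auto
  qed
  ultimately show ?thesis by blast
qed

text \<open>The choice is unique, since partial sums determine a composition by
  \<open>psums_inj\<close>.\<close>

definition peak_of :: "composition \<Rightarrow> composition"
  where "peak_of \<beta> = (SOME \<alpha>. peak_composition \<alpha> \<and> weight \<alpha> = weight \<beta> \<and>
    psums \<alpha> = Suc ` (psums \<beta> - {weight \<beta>}) \<union> psums \<beta> \<inter> {weight \<beta>})"

lemma peak_of:
  assumes "sparse \<beta>"
  shows "peak_composition (peak_of \<beta>)" "weight (peak_of \<beta>) = weight \<beta>"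
    "psums (peak_of \<beta>) = Suc ` (psums \<beta> - {weight \<beta>}) \<union> psums \<beta> \<inter> {weight \<beta>}"
  using someI_ex[OF sparse_to_peak[OF assms]] unfolding peak_of_def by blast+

text \<open>The partial sums of \<open>peak_of \<beta>\<close> are the total and successors of
  partial sums of \<open>\<beta>\<close>, exactly what \<open>star_refines_iff\<close>
  allows.\<close>

lemma theta_coeff_peak_of_diag:
  assumes "sparse \<beta>"
  shows "theta_coeff (peak_of \<beta>) \<beta> \<noteq> 0"
  by (auto simp: theta_coeff_def star_refines_iff peak_of[OF assms])

text \<open>
  If \<open>\<theta>\<close> of the peak composition attached to \<open>\<beta>\<close> is nonzero at \<open>\<gamma>\<close>, then every partial sum
  \<open>d\<close> of \<open>\<beta>\<close> is matched with one of the partial sums \<open>d\<close>, \<open>d + 1\<close> of \<open>\<gamma>\<close>; the matching is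
  injective because the partial sums of \<open>\<beta>\<close> are not adjacent.
\<close>

lemma theta_coeff_peak_of_less:
  assumes "sparse \<beta>" "theta_coeff (peak_of \<beta>) \<gamma> \<noteq> 0" "\<beta> \<noteq> \<gamma>"
  shows "\<Sum>(psums \<beta>) < \<Sum>(psums \<gamma>)"
proof -
  have w: "weight \<gamma> = weight \<beta>"
    and sub: "psums (peak_of \<beta>) \<subseteq> psums \<gamma> \<union> Suc ` psums \<gamma>"
    using assms(2) by (auto simp: theta_coeff_def star_refines_iff peak_of[OF assms(1)])
  have match: "d \<in> psums \<gamma> \<or> Suc d \<in> psums \<gamma>" if d: "d \<in> psums \<beta>" for d
  proof (cases "d = weight \<beta>")
    case True
    then show ?thesis using psums_bounds[OF d] weight_in_psums[of \<gamma>] w by auto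
  next
    case False
    then have "Suc d \<in> psums \<gamma> \<union> Suc ` psums \<gamma>"
      using d sub unfolding peak_of(3)[OF assms(1)] by blast
    then show ?thesis by auto
  qed
  have fin: "finite (psums \<beta>)" for \<beta> by (simp add: psums_def finite_partial_sums)
  define \<phi> where "\<phi> d = (if d \<in> psums \<gamma> then d else Suc d)" for d
  have inj: "inj_on \<phi> (psums \<beta>)"
    using sparse_nonadjacent[OF assms(1)] by (auto simp: inj_on_def \<phi>_def)
  have img: "\<phi> ` psums \<beta> \<subseteq> psums \<gamma>" using match by (auto simp: \<phi>_def)
  have le: "sum \<phi> (psums \<beta>) \<le> \<Sum>(psums \<gamma>)"
    using sum_mono2[OF fin img, of "\<lambda>x. x"] by (simp add: sum.reindex[OF inj])
  show ?thesis
  \<comment> \<open>Either the inclusion is strict by \<open>psums_inj\<close> and an extra positive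
    term appears, or \<open>\<phi>\<close> raises some partial sum by one.\<close>
  proof (cases "psums \<beta> \<subseteq> psums \<gamma>")
    case True
    then have "psums \<beta> \<subset> psums \<gamma>" using assms(3) psums_inj by blast
    then obtain d where "d \<in> psums \<gamma> - psums \<beta>" by blast
    then show ?thesis
      using psums_bounds[of d \<gamma>] fin True by (intro sum_strict_mono2[of _ _ d]) auto
  next
    case False
    then have "\<Sum>(psums \<beta>) < sum \<phi> (psums \<beta>)"
      using fin by (intro sum_strict_mono_ex1) (auto simp: \<phi>_def)
    with le show ?thesis by simp
  qed
qed

section \<open>Matching a functional by peak functions\<close>

lemma triangular_system_solvable:
  fixes T :: "'a \<Rightarrow> 'a \<Rightarrow> 'b::field" and r :: "'a \<Rightarrow> nat"
  assumes "finite A" "\<And>a. a \<in> A \<Longrightarrow> T a a \<noteq> 0"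
    and "\<And>a b. a \<in> A \<Longrightarrow> b \<in> A \<Longrightarrow> a \<noteq> b \<Longrightarrow> T a b \<noteq> 0 \<Longrightarrow> r a < r b"
  shows "\<exists>c. \<forall>b\<in>A. f b = (\<Sum>a\<in>A. c a * T a b)"
proof -
  \<comment> \<open>Forward substitution: once the equations of rank below \<open>k\<close> are
    solved, those of rank \<open>k\<close> are added.\<close>
  have "\<exists>c. \<forall>b\<in>A. r b < k \<longrightarrow> f b = (\<Sum>a\<in>A. c a * T a b)" for k
  proof (induction k)
    case (Suc k)
    then obtain c where c: "\<And>b. b \<in> A \<Longrightarrow> r b < k \<Longrightarrow> f b = (\<Sum>a\<in>A. c a * T a b)" by blast
    \<comment> \<open>Only rank \<open>k\<close> is corrected, by residual over pivot. Such an
      \<open>a\<close> has \<open>T a b = 0\<close> for every other \<open>b\<close> of rank at most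
      \<open>k\<close>, so no solved equation is disturbed.\<close>
    define c' where "c' a = c a + (if r a = k then (f a - (\<Sum>b\<in>A. c b * T b a)) / T a a else 0)" for a
    have "f b = (\<Sum>a\<in>A. c' a * T a b)" if b: "b \<in> A" "r b \<le> k" for b
    proof -
      have "(\<Sum>a\<in>A. c' a * T a b) =
          (\<Sum>a\<in>A. c a * T a b + (if a = b then f b - (\<Sum>a\<in>A. c a * T a b) else 0))"
      proof (rule sum.cong[OF refl])
        fix a assume a: "a \<in> A"
        show "c' a * T a b = c a * T a b + (if a = b then f b - (\<Sum>a\<in>A. c a * T a b) else 0)"
        proof (cases "a = b")
          case True
          then show ?thesis
            using assms(2) a b c[of b] by (cases "r b = k") (auto simp: c'_def distrib_right)
        next
          case False
          then show ?thesis using assms(3)[OF a b(1)] b by (auto simp: c'_def)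
        qed
      qed
      then show ?thesis using assms(1) b by (simp add: sum.distrib)
    qed
    then show ?case by (intro exI[of _ c']) (auto simp: less_Suc_eq_le)
  qed simp
  then obtain c where "\<forall>b\<in>A. r b < Suc (Max (r ` A)) \<longrightarrow> f b = (\<Sum>a\<in>A. c a * T a b)" by blast
  then show ?thesis using assms(1) by (intro exI[of _ c]) (simp add: less_Suc_eq_le)
qed

lemma kills_diff: "kills F \<Longrightarrow> kills G \<Longrightarrow> kills (\<lambda>\<beta>. F \<beta> - G \<beta>)"
  by (simp add: kills_def algebra_simps sum_subtractf)

lemma kills_sum:
  assumes "\<And>a. a \<in> A \<Longrightarrow> kills (F a)"
  shows "kills (\<lambda>\<beta>. \<Sum>a\<in>A. c a * F a \<beta>)"
  unfolding kills_def
proof (intro allI impI)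
  fix \<gamma> \<delta> and n :: nat assume n: "n \<ge> 1"
  have "(\<Sum>i\<le>2 * n. (- 1) ^ i * (\<Sum>a\<in>A. c a * F a (\<gamma> + letter i + letter (2 * n - i) + \<delta>))) =
      (\<Sum>a\<in>A. c a * (\<Sum>i\<le>2 * n. (- 1) ^ i * F a (\<gamma> + letter i + letter (2 * n - i) + \<delta>)))"
    unfolding sum_distrib_left by (subst sum.swap) (simp add: algebra_simps)
  also have "\<dots> = 0" using assms n by (intro sum.neutral) (simp add: kills_def)
  finally show "(\<Sum>i\<le>2 * n. (- 1) ^ i * (\<Sum>a\<in>A. c a * F a (\<gamma> + letter i + letter (2 * n - i) + \<delta>))) = 0" .
qed

lemma kills_imp_theta_combination:
  assumes "kills F" "finite {\<beta>. F \<beta> \<noteq> 0}"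
  shows "\<exists>A c. (\<forall>\<alpha>\<in>A. sparse \<alpha>) \<and> (\<forall>\<beta>. F \<beta> = (\<Sum>\<alpha>\<in>A. c \<alpha> * theta_coeff (peak_of \<alpha>) \<beta>))"
proof -
  \<comment> \<open>\<open>insert 0\<close> keeps the set nonempty when \<open>F\<close> vanishes
    identically.\<close>
  define N where "N = Max (insert 0 (weight ` {\<beta>. F \<beta> \<noteq> 0}))"
  have N: "F \<beta> = 0" if "weight \<beta> > N" for \<beta>
  proof (rule ccontr)
    assume "F \<beta> \<noteq> 0"
    then have "weight \<beta> \<le> N" unfolding N_def using assms(2) by (intro Max_ge) auto
    with that show False by simp
  qed
  define A where "A = {\<beta>. sparse \<beta> \<and> weight \<beta> \<le> N}"
  have "A \<subseteq> (\<Union>m\<le>N. {\<beta>. weight \<beta> = m})" by (auto simp: A_def)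
  then have "finite A" by (rule finite_subset) (simp add: finite_weight)
  then obtain c where c: "\<forall>\<beta>\<in>A. F \<beta> = (\<Sum>\<alpha>\<in>A. c \<alpha> * theta_coeff (peak_of \<alpha>) \<beta>)"
    using triangular_system_solvable[of A "\<lambda>\<alpha>. theta_coeff (peak_of \<alpha>)" "\<lambda>\<beta>. \<Sum>(psums \<beta>)" F]
      theta_coeff_peak_of_diag theta_coeff_peak_of_less by (auto simp: A_def)
  define G where "G \<beta> = F \<beta> - (\<Sum>\<alpha>\<in>A. c \<alpha> * theta_coeff (peak_of \<alpha>) \<beta>)" for \<beta>
  have "kills G"
    unfolding G_def using assms(1) kills_theta_coeff peak_of(1)
    by (intro kills_diff kills_sum) (auto simp: A_def)
  \<comment> \<open>Up to weight \<open>N\<close> this is the choice of \<open>c\<close>; beyond it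
    both terms vanish, as \<open>peak_of\<close> preserves weight.\<close>
  moreover have "G \<beta> = 0" if "sparse \<beta>" for \<beta>
  proof (cases "weight \<beta> \<le> N")
    case True
    then show ?thesis using that c by (simp add: G_def A_def)
  next
    case False
    then have "theta_coeff (peak_of \<alpha>) \<beta> = 0" if "\<alpha> \<in> A" for \<alpha>
      using that by (auto simp: theta_coeff_def A_def peak_of(2))
    then show ?thesis using N False by (simp add: G_def)
  qed
  ultimately have "G \<beta> = 0" for \<beta> by (rule kills_sparse_zero)
  then have "(\<forall>\<alpha>\<in>A. sparse \<alpha>) \<and> (\<forall>\<beta>. F \<beta> = (\<Sum>\<alpha>\<in>A. c \<alpha> * theta_coeff (peak_of \<alpha>) \<beta>))"
    by (auto simp: G_def A_def)
  then show ?thesis by blast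
qed

section \<open>Quasi-symmetric functions as functionals\<close>

text \<open>By \<open>pairing_S\<close> this is the value of the functional on
  \<open>S \<alpha>\<close>, the kind of table to which \<open>kills\<close> applies.\<close>

definition coeff :: "rat series \<Rightarrow> composition \<Rightarrow> rat"
  where "coeff f \<alpha> = f (exponent [0..<len \<alpha>] \<alpha>)"

text \<open>Members of \<open>qsymQ\<close> depend only on the shape of an exponent, and each shape
  is sampled by some composition.\<close>

lemma coeff_inject:
  assumes "f \<in> qsymQ" "g \<in> qsymQ" "\<And>\<alpha>. coeff f \<alpha> = coeff g \<alpha>"
  shows "f = g"
proof
  fix e
  obtain \<alpha> where "parts \<alpha> = shape e" using exponent_shape by blast
  then have "shape e = shape (exponent [0..<len \<alpha>] \<alpha>)" by (simp add: shape_exponent)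
  then have "f e = coeff f \<alpha>" "g e = coeff g \<alpha>"
    unfolding coeff_def using assms(1,2) by (auto intro: qsymQ_shape)
  then show "f e = g e" using assms(3) by simp
qed

lemma finite_support_linear:
  fixes F G :: "'a \<Rightarrow> 'b::ring"
  assumes "finite {\<alpha>. F \<alpha> \<noteq> 0}" "finite {\<alpha>. G \<alpha> \<noteq> 0}"
  shows "finite {\<alpha>. c * F \<alpha> + G \<alpha> \<noteq> 0}"
  by (rule finite_subset[OF _ finite_UnI[OF assms]]) auto

text \<open>This bounds the linear system above and gives the finiteness condition of the graded
  dual.\<close>

lemma finite_coeff:
  assumes "f \<in> qsymQ"
  shows "finite {\<alpha>. coeff f \<alpha> \<noteq> 0}"
proof -
  have int: "finite {\<alpha>. g (exponent [0..<len \<alpha>] \<alpha>) \<noteq> 0}" if "g \<in> qsym" for g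
    using that unfolding qsym_def
  proof (induction rule: series.span_induct_alt)
    case (step c x y)
    then obtain \<beta> where x: "x = M \<beta>" by blast
    have "{\<alpha>. x (exponent [0..<len \<alpha>] \<alpha>) \<noteq> 0} \<subseteq> {\<beta>}"
      by (auto simp: x M_shape shape_exponent parts_inject)
    then have "finite {\<alpha>. x (exponent [0..<len \<alpha>] \<alpha>) \<noteq> 0}" by (rule finite_subset) simp
    then show ?case using step.IH by (simp add: series_scale_def finite_support_linear)
  qed simp
  show ?thesis
    using assms unfolding qsymQ_def coeff_def
  proof (induction rule: series.span_induct_alt)
    case (step c x y)
    then have "finite {\<alpha>. x (exponent [0..<len \<alpha>] \<alpha>) \<noteq> 0}" using int by auto
    then show ?case using step.IH by (simp add: series_scale_def finite_support_linear)
  qed simp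
qed

section \<open>Linearity of the pairing and the annihilator\<close>

lemma pairing_superset:
  assumes "finite A" "Poly_Mapping.keys x \<subseteq> A"
  shows "pairing f x = (\<Sum>\<alpha>\<in>A. coeff f \<alpha> * Poly_Mapping.lookup x \<alpha>)"
  unfolding pairing_def coeff_def
  by (rule sum.mono_neutral_left) (use assms in \<open>auto simp: in_keys_iff\<close>)

lemma pairing_add: "pairing f (x + y) = pairing f x + pairing f y"
proof -
  let ?A = "Poly_Mapping.keys x \<union> Poly_Mapping.keys y"
  have "Poly_Mapping.keys (x + y) \<subseteq> ?A" by (rule keys_add)
  then show ?thesis
    by (simp add: pairing_superset[of ?A] lookup_add algebra_simps sum.distrib)
qed

lemma lookup_nc_scale: "Poly_Mapping.lookup (nc_scale c x) \<alpha> = c * Poly_Mapping.lookup x \<alpha>"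
proof -
  have "nc_scale c x = (\<Sum>\<beta>\<in>Poly_Mapping.keys x. nc_scale c (nc_scale (Poly_Mapping.lookup x \<beta>) (S \<beta>)))"
    by (subst nc_expand) (rule nc.scale_sum_right)
  also have "Poly_Mapping.lookup \<dots> \<alpha> = c * Poly_Mapping.lookup x \<alpha>"
    by (simp add: lookup_sum nc_scale_def S_eq_single mult_single lookup_single when_def in_keys_iff)
  finally show ?thesis .
qed

lemma pairing_scale: "pairing f (nc_scale c x) = c * pairing f x"
proof -
  have "Poly_Mapping.keys (nc_scale c x) \<subseteq> Poly_Mapping.keys x"
    by (auto simp: in_keys_iff lookup_nc_scale)
  then show ?thesis
    by (simp add: pairing_superset[of "Poly_Mapping.keys x"] lookup_nc_scale sum_distrib_left algebra_simps)
qed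

lemma pairing_0 [simp]: "pairing f 0 = 0"
  by (simp add: pairing_def)

lemma pairing_add_left: "pairing (f + g) x = pairing f x + pairing g x"
  by (simp add: pairing_def algebra_simps sum.distrib)

lemma pairing_scale_left: "pairing (series_scale c f) x = c * pairing f x"
  by (simp add: pairing_def series_scale_def algebra_simps sum_distrib_left)

text \<open>\<open>ideal_I\<close> lives over the integers, so the ideal argument is made there
  before passing to the rational span.\<close>

definition int_pairing :: "rat series \<Rightarrow> (composition \<Rightarrow>\<^sub>0 int) \<Rightarrow> rat"
  where "int_pairing f x = pairing f (Poly_Mapping.map rat_of_int x)"

lemma lookup_map_of_int:
  "Poly_Mapping.lookup (Poly_Mapping.map rat_of_int x) \<alpha> = rat_of_int (Poly_Mapping.lookup x \<alpha>)"
  by (simp add: Poly_Mapping.map.rep_eq when_def)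

lemma int_pairing_0: "int_pairing f 0 = 0"
  unfolding int_pairing_def by (simp add: pairing_def in_keys_iff lookup_map_of_int)

lemma int_pairing_add: "int_pairing f (x + y) = int_pairing f x + int_pairing f y"
proof -
  have "Poly_Mapping.map rat_of_int (x + y) = Poly_Mapping.map rat_of_int x + Poly_Mapping.map rat_of_int y"
    by (rule poly_mapping_eqI) (simp add: lookup_map_of_int lookup_add)
  then show ?thesis by (simp add: int_pairing_def pairing_add)
qed

lemma int_pairing_sum: "int_pairing f (\<Sum>a\<in>A. x a) = (\<Sum>a\<in>A. int_pairing f (x a))"
  by (induction A rule: infinite_finite_induct) (simp_all add: int_pairing_0 int_pairing_add)

lemma int_pairing_single:
  "int_pairing f (Poly_Mapping.single \<alpha> c) = of_int c * coeff f \<alpha>"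
proof -
  have "Poly_Mapping.keys (Poly_Mapping.map rat_of_int (Poly_Mapping.single \<alpha> c)) \<subseteq> {\<alpha>}"
    by (auto simp: in_keys_iff lookup_map_of_int lookup_single when_def split: if_splits)
  then show ?thesis
    unfolding int_pairing_def
    by (subst pairing_superset[of "{\<alpha>}"]) (auto simp: lookup_map_of_int)
qed

lemma poly_mapping_expand:
  fixes x :: "composition \<Rightarrow>\<^sub>0 'a::comm_ring_1"
  shows "x = (\<Sum>\<alpha>\<in>Poly_Mapping.keys x. Poly_Mapping.single \<alpha> (Poly_Mapping.lookup x \<alpha>))"
  using nc_expand[of x] by (simp add: nc_scale_def S_eq_single mult_single)

lemma X_eq: "X n = (\<Sum>i\<le>2 * n. Poly_Mapping.single (letter i + letter (2 * n - i)) ((- 1) ^ i))"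
proof -
  have h: "h k = Poly_Mapping.single (letter k) (1 :: 'a)" for k
    by (cases "k = 0") (simp_all add: h_def letter_def flip: zero_composition_def)
  show ?thesis
    unfolding X_def by (intro sum.cong) (auto simp: h mult_single minus_one_power_iff single_uminus)
qed

text \<open>Multiples by single words give the sums in \<open>kills\<close>; general multipliers
  reduce to them by linearity.\<close>

lemma int_pairing_X:
  "int_pairing f (Poly_Mapping.single \<gamma> a * X n * Poly_Mapping.single \<delta> b) =
    of_int (a * b) * (\<Sum>i\<le>2 * n. (- 1) ^ i * coeff f (\<gamma> + letter i + letter (2 * n - i) + \<delta>))"
  by (simp add: X_eq sum_distrib_left sum_distrib_right mult_single int_pairing_sum
      int_pairing_single algebra_simps)

lemma annihilator_iff: "f \<in> annihilator \<longleftrightarrow> f \<in> qsymQ \<and> kills (coeff f)"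
proof -
  have "kills (coeff f)" if f: "\<forall>x\<in>ideal_IQ. pairing f x = 0"
    unfolding kills_def
  proof (intro allI impI)
    fix \<gamma> \<delta> and n :: nat assume "n \<ge> 1"
    let ?x = "Poly_Mapping.single \<gamma> 1 * X n * Poly_Mapping.single \<delta> 1 :: composition \<Rightarrow>\<^sub>0 int"
    have "two_sided_ideal ideal_I"
      unfolding ideal_I_def by (rule hull_in) (auto simp: two_sided_ideal_def)
    moreover have "X n \<in> ideal_I"
      unfolding ideal_I_def using \<open>n \<ge> 1\<close> by (auto intro: hull_inc)
    ultimately have "?x \<in> ideal_I"
      unfolding two_sided_ideal_def by blast
    then have "int_pairing f ?x = 0"
      unfolding int_pairing_def using f by (auto simp: ideal_IQ_def intro: nc.span_base)
    then show "(\<Sum>i\<le>2 * n. (- 1) ^ i * coeff f (\<gamma> + letter i + letter (2 * n - i) + \<delta>)) = 0"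
      by (simp add: int_pairing_X)
  qed
  moreover have "\<forall>x\<in>ideal_IQ. pairing f x = 0" if f: "kills (coeff f)"
  proof -
    \<comment> \<open>The largest two-sided ideal on which the functional vanishes; it contains
      \<open>ideal_I\<close> as soon as it contains the generators.\<close>
    define J where "J = {x. \<forall>u v. int_pairing f (u * x * v) = 0}"
    have "two_sided_ideal J"
      unfolding two_sided_ideal_def J_def
    proof (safe, goal_cases)
      case 1
      show ?case by (simp add: int_pairing_0)
    next
      case (2 x y u v)
      then show ?case by (simp add: distrib_left distrib_right int_pairing_add)
    next
      case (3 x r u v)
      then show ?case using 3[rule_format, of "u * r" v] by (simp add: mult.assoc)
    next
      case (4 x r u v)
      then show ?case using 4[rule_format, of u "r * v"] by (simp add: mult.assoc)
    qed
    moreover have "X n \<in> J" if "n \<ge> 1" for n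
      unfolding J_def
    proof safe
      fix u v :: "composition \<Rightarrow>\<^sub>0 int"
      have "int_pairing f ((\<Sum>\<gamma>\<in>Poly_Mapping.keys u. Poly_Mapping.single \<gamma> (Poly_Mapping.lookup u \<gamma>)) * X n *
          (\<Sum>\<delta>\<in>Poly_Mapping.keys v. Poly_Mapping.single \<delta> (Poly_Mapping.lookup v \<delta>))) = 0"
        using f that
        by (simp add: sum_distrib_left sum_distrib_right int_pairing_sum int_pairing_X kills_def)
      then show "int_pairing f (u * X n * v) = 0"
        by (simp flip: poly_mapping_expand)
    qed
    ultimately have "ideal_I \<subseteq> J"
      unfolding ideal_I_def by (intro hull_minimal) auto
    then have "int_pairing f (1 * x * 1) = 0" if "x \<in> ideal_I" for x
      using that by (auto simp only: J_def)
    then have I: "pairing f (Poly_Mapping.map rat_of_int x) = 0" if "x \<in> ideal_I" for x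
      using that by (simp add: int_pairing_def)
    show ?thesis
    proof
      fix x assume "x \<in> ideal_IQ"
      then show "pairing f x = 0"
        unfolding ideal_IQ_def
        by (induction rule: nc.span_induct_alt) (auto simp: pairing_add pairing_scale I)
    qed
  qed
  ultimately show ?thesis by (auto simp: annihilator_def)
qed

section \<open>The peak algebra as annihilator\<close>

definition \<theta>Q :: "composition \<Rightarrow> rat series"
  where "\<theta>Q \<alpha> = (\<lambda>e. rat_of_int (\<theta> \<alpha> e))"

lemma theta_in_qsym: "\<theta> \<alpha> \<in> qsym"
  unfolding \<theta>_def qsym_def
  by (intro series.span_sum series.span_scale series.span_base) auto

lemma thetaQ_in_qsymQ: "\<theta>Q \<alpha> \<in> qsymQ"
  unfolding \<theta>Q_def qsymQ_def using theta_in_qsym by (intro series.span_base) auto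

lemma sum_apply: "(\<Sum>a\<in>A. g a) e = (\<Sum>a\<in>A. g a e)"
  for g :: "'a \<Rightarrow> 'b \<Rightarrow> 'c::comm_monoid_add"
  by (induction A rule: infinite_finite_induct) auto

lemma coeff_thetaQ: "coeff (\<theta>Q \<alpha>) \<beta> = theta_coeff \<alpha> \<beta>"
proof -
  let ?B = "{\<beta>. weight \<beta> = weight \<alpha> \<and> star \<beta> \<preceq> \<alpha>}"
  have "finite ?B" by (rule finite_subset[OF _ finite_weight[of "weight \<alpha>"]]) auto
  have "\<theta> \<alpha> (exponent [0..<len \<beta>] \<beta>) = (\<Sum>\<gamma>\<in>?B. if \<gamma> = \<beta> then 2 ^ len \<beta> else 0)"
    unfolding \<theta>_def sum_apply
    by (intro sum.cong) (auto simp: series_scale_def M_shape shape_exponent parts_inject)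
  also have "\<dots> = (if \<beta> \<in> ?B then 2 ^ len \<beta> else 0)" using \<open>finite ?B\<close> by simp
  finally show ?thesis by (simp add: coeff_def \<theta>Q_def theta_coeff_def)
qed

lemma annihilator_subspace: "series.subspace annihilator"
proof -
  have "series.subspace qsymQ" unfolding qsymQ_def by (rule series.subspace_span)
  then show ?thesis
    unfolding series.subspace_def annihilator_def
    by (auto simp: pairing_add_left pairing_scale_left) (simp add: pairing_def)
qed

lemma annihilator_eq_peak_algebraQ: "annihilator = peak_algebraQ"
proof
  have theta: "\<theta>Q \<alpha> \<in> annihilator" if "peak_composition \<alpha>" for \<alpha>
    using kills_theta_coeff[OF that] by (simp add: annihilator_iff thetaQ_in_qsymQ coeff_thetaQ[abs_def])
  \<comment> \<open>\<open>peak_algebraQ\<close> is a rational span of an integral span; the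
    integral span is handled first.\<close>
  have "(\<lambda>e. rat_of_int (f e)) \<in> annihilator" if "f \<in> peak_algebra" for f
    using that unfolding peak_algebra_def
  proof (induction rule: series.span_induct_alt)
    case base
    then show ?case using series.subspace_0[OF annihilator_subspace] by (simp add: zero_fun_def)
  next
    case (step c x y)
    then obtain \<alpha> where \<alpha>: "x = \<theta> \<alpha>" "peak_composition \<alpha>" by blast
    have "(\<lambda>e. rat_of_int ((series_scale c x + y) e)) =
        series_scale (of_int c) (\<theta>Q \<alpha>) + (\<lambda>e. rat_of_int (y e))"
      by (simp add: fun_eq_iff series_scale_def \<theta>Q_def \<alpha>)
    then show ?case
      using theta[OF \<alpha>(2)] step.IH annihilator_subspace
      by (simp add: series.subspace_add series.subspace_scale)
  qed
  then show "peak_algebraQ \<subseteq> annihilator"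
    unfolding peak_algebraQ_def by (intro series.span_minimal annihilator_subspace) auto
next
  show "annihilator \<subseteq> peak_algebraQ"
  proof
    fix f assume "f \<in> annihilator"
    then have f: "f \<in> qsymQ" "kills (coeff f)" by (simp_all add: annihilator_iff)
    then obtain A c where A: "\<And>\<alpha>. \<alpha> \<in> A \<Longrightarrow> sparse \<alpha>"
      and c: "\<And>\<beta>. coeff f \<beta> = (\<Sum>\<alpha>\<in>A. c \<alpha> * theta_coeff (peak_of \<alpha>) \<beta>)"
      using kills_imp_theta_combination[OF f(2) finite_coeff[OF f(1)]] by blast
    let ?g = "\<Sum>\<alpha>\<in>A. series_scale (c \<alpha>) (\<theta>Q (peak_of \<alpha>))"
    have "coeff ?g \<beta> = (\<Sum>\<alpha>\<in>A. c \<alpha> * coeff (\<theta>Q (peak_of \<alpha>)) \<beta>)" for \<beta>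
      by (simp add: coeff_def sum_apply series_scale_def)
    moreover have "?g \<in> qsymQ"
      using thetaQ_in_qsymQ unfolding qsymQ_def by (intro series.span_sum series.span_scale)
    ultimately have "f = ?g"
      using f c by (intro coeff_inject) (simp_all add: coeff_thetaQ)
    moreover have "\<theta>Q (peak_of \<alpha>) \<in> peak_algebraQ" if "\<alpha> \<in> A" for \<alpha>
      unfolding peak_algebraQ_def peak_algebra_def \<theta>Q_def
      using peak_of(1)[OF A[OF that]] by (intro series.span_base imageI) blast
    then have "?g \<in> peak_algebraQ"
      unfolding peak_algebraQ_def by (intro series.span_sum series.span_scale)
    ultimately show "f \<in> peak_algebraQ" by simp
  qed
qed

section \<open>The graded dual and the transpose of the projection\<close>

lemma transpose_proj:
  assumes "\<phi> \<in> graded_dual"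
  shows "transpose_proj \<phi> \<in> qsymQ" "pairing (transpose_proj \<phi>) x = \<phi> (proj x)"
  using theI'[OF transpose_ex1[OF assms]] unfolding transpose_proj_def by blast+

lemma transpose_proj_eqI:
  assumes "\<phi> \<in> graded_dual" "f \<in> qsymQ" "\<And>x. pairing f x = \<phi> (proj x)"
  shows "transpose_proj \<phi> = f"
  unfolding transpose_proj_def using transpose_ex1[OF assms(1)] assms(2,3) by (intro the1_equality) auto

lemma proj_eq_iff: "proj x = proj y \<longleftrightarrow> x - y \<in> ideal_IQ"
  using Quotient_rel_abs[OF Quotient_ncq] Quotient_rel[OF Quotient_ncq]
  by (metis ncq.abs_eq_iff)

lemma proj_rep: "proj (rep_ncq q) = q"
  by (rule Quotient_abs_rep[OF Quotient_ncq])

lemma proj_simps: "proj (x + y) = proj x + proj y" "proj (nc_scale c x) = ncq_scale c (proj x)" "proj 0 = 0"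
  by (simp_all add: plus_ncq.abs_eq ncq_scale.abs_eq zero_ncq.abs_eq)

lemma linear_iff_rat:
  "Vector_Spaces.linear ncq_scale (*) \<phi> \<longleftrightarrow>
    (\<forall>x y. \<phi> (x + y) = \<phi> x + \<phi> y) \<and> (\<forall>c x. \<phi> (ncq_scale c x) = c * \<phi> x)"
  for \<phi> :: "ncq \<Rightarrow> rat"
  unfolding Vector_Spaces.linear_iff
  by (auto simp: ncq.vector_space_axioms vector_space_def algebra_simps)

lemma graded_dual_add:
  assumes "\<phi> \<in> graded_dual" "\<psi> \<in> graded_dual"
  shows "\<phi> + \<psi> \<in> graded_dual"
proof -
  have "{n. \<exists>x\<in>nc_degree n. (\<phi> + \<psi>) (proj x) \<noteq> 0} \<subseteq>
      {n. \<exists>x\<in>nc_degree n. \<phi> (proj x) \<noteq> 0} \<union> {n. \<exists>x\<in>nc_degree n. \<psi> (proj x) \<noteq> 0}"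
    by fastforce
  then show ?thesis
    using assms by (auto simp: graded_dual_def linear_iff_rat algebra_simps intro: finite_subset)
qed

lemma graded_dual_scale:
  assumes "\<phi> \<in> graded_dual"
  shows "(\<lambda>x. c * \<phi> x) \<in> graded_dual"
proof -
  have "{n. \<exists>x\<in>nc_degree n. c * \<phi> (proj x) \<noteq> 0} \<subseteq> {n. \<exists>x\<in>nc_degree n. \<phi> (proj x) \<noteq> 0}"
    by fastforce
  then show ?thesis
    using assms by (auto simp: graded_dual_def linear_iff_rat algebra_simps intro: finite_subset)
qed

lemma annihilator_imp_transpose:
  assumes "f \<in> annihilator"
  shows "\<exists>\<phi>\<in>graded_dual. \<forall>x. \<phi> (proj x) = pairing f x"
proof -
  have f: "f \<in> qsymQ" "\<And>x. x \<in> ideal_IQ \<Longrightarrow> pairing f x = 0"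
    using assms by (auto simp: annihilator_def)
  \<comment> \<open>The choice of representative is harmless because the pairing with
    \<open>f\<close> vanishes on \<open>ideal_IQ\<close>.\<close>
  define \<phi> where "\<phi> q = pairing f (rep_ncq q)" for q
  have \<phi>: "\<phi> (proj x) = pairing f x" for x
  proof -
    have "rep_ncq (proj x) - x \<in> ideal_IQ" using proj_rep proj_eq_iff by blast
    then show ?thesis
      using pairing_add[of f "rep_ncq (proj x) - x" x] f(2) by (simp add: \<phi>_def)
  qed
  have "\<phi> (p + q) = \<phi> p + \<phi> q" "\<phi> (ncq_scale c p) = c * \<phi> p" for p q c
    using \<phi>[of "rep_ncq p + rep_ncq q"] \<phi>[of "nc_scale c (rep_ncq p)"]
    by (simp_all add: proj_simps proj_rep pairing_add pairing_scale flip: \<phi>_def)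
  \<comment> \<open>Degree \<open>n\<close> is spanned by the \<open>S \<alpha>\<close> of weight
    \<open>n\<close>, so a nonzero value there needs a nonzero coefficient of that weight.\<close>
  moreover have "{n. \<exists>x\<in>nc_degree n. \<phi> (proj x) \<noteq> 0} \<subseteq> weight ` {\<alpha>. coeff f \<alpha> \<noteq> 0}"
  proof
    fix n assume n: "n \<in> {n. \<exists>x\<in>nc_degree n. \<phi> (proj x) \<noteq> 0}"
    show "n \<in> weight ` {\<alpha>. coeff f \<alpha> \<noteq> 0}"
    proof (rule ccontr)
      assume "n \<notin> weight ` {\<alpha>. coeff f \<alpha> \<noteq> 0}"
      then have S: "pairing f (S \<alpha>) = 0" if "weight \<alpha> = n" for \<alpha>
        using that by (auto simp: pairing_S coeff_def)
      have "pairing f x = 0" if "x \<in> nc_degree n" for x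
        using that unfolding nc_degree_def
        by (induction rule: nc.span_induct_alt) (auto simp: pairing_add pairing_scale S)
      then show False using n \<phi> by auto
    qed
  qed
  then have "finite {n. \<exists>x\<in>nc_degree n. \<phi> (proj x) \<noteq> 0}"
    by (rule finite_subset) (simp add: finite_coeff f)
  ultimately have "\<phi> \<in> graded_dual" by (simp add: graded_dual_def linear_iff_rat)
  with \<phi> show ?thesis by blast
qed

theorem theorem5p4:
  shows "(\<forall>\<phi>\<in>graded_dual. \<forall>\<psi>\<in>graded_dual.
            transpose_proj (\<phi> + \<psi>) = transpose_proj \<phi> + transpose_proj \<psi>) \<and>
         (\<forall>c. \<forall>\<phi>\<in>graded_dual.
            transpose_proj (\<lambda>x. c * \<phi> x) = series_scale c (transpose_proj \<phi>)) \<and>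
         bij_betw transpose_proj graded_dual annihilator \<and>
         annihilator = peak_algebraQ"
proof (intro conjI ballI allI)
  fix \<phi> \<psi> assume "\<phi> \<in> graded_dual" "\<psi> \<in> graded_dual"
  then show "transpose_proj (\<phi> + \<psi>) = transpose_proj \<phi> + transpose_proj \<psi>"
    using transpose_proj
    by (intro transpose_proj_eqI graded_dual_add)
      (auto simp: pairing_add_left qsymQ_def series.span_add)
next
  fix c \<phi> assume "\<phi> \<in> graded_dual"
  then show "transpose_proj (\<lambda>x. c * \<phi> x) = series_scale c (transpose_proj \<phi>)"
    using transpose_proj
    by (intro transpose_proj_eqI graded_dual_scale)
      (auto simp: pairing_scale_left qsymQ_def series.span_scale)
next
  show "bij_betw transpose_proj graded_dual annihilator"
    unfolding bij_betw_def
  proof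
    show "inj_on transpose_proj graded_dual"
    proof (rule inj_onI, rule ext)
      fix \<phi> \<psi> q assume "\<phi> \<in> graded_dual" "\<psi> \<in> graded_dual" "transpose_proj \<phi> = transpose_proj \<psi>"
      \<comment> \<open>Every \<open>q\<close> is the projection of its representative, so the
        pairing with the transpose determines the functional.\<close>
      then show "\<phi> q = \<psi> q"
        using transpose_proj(2)[of \<phi> "rep_ncq q"] transpose_proj(2)[of \<psi> "rep_ncq q"]
        by (simp add: proj_rep)
    qed
    show "transpose_proj ` graded_dual = annihilator"
    proof (intro equalityI subsetI)
      fix f assume "f \<in> transpose_proj ` graded_dual"
      then obtain \<phi> where \<phi>: "\<phi> \<in> graded_dual" "f = transpose_proj \<phi>" by blast
      have "\<phi> 0 = 0"
        using transpose_proj(2)[OF \<phi>(1), of 0] by (simp add: proj_simps)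
      moreover have "proj x = 0" if "x \<in> ideal_IQ" for x
        using that proj_eq_iff[of x 0] by (simp add: proj_simps)
      ultimately show "f \<in> annihilator"
        using transpose_proj[OF \<phi>(1)] \<phi> by (simp add: annihilator_def)
    next
      fix f assume f: "f \<in> annihilator"
      then obtain \<phi> where "\<phi> \<in> graded_dual" "\<And>x. \<phi> (proj x) = pairing f x"
        using annihilator_imp_transpose by blast
      moreover have "f \<in> qsymQ" using f by (simp add: annihilator_def)
      ultimately have "transpose_proj \<phi> = f" by (intro transpose_proj_eqI) simp_all
      with \<open>\<phi> \<in> graded_dual\<close> show "f \<in> transpose_proj ` graded_dual" by blast
    qed
  qed
qed (rule annihilator_eq_peak_algebraQ)

end
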